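(* Let $A_c\in\mathbb{R}^{n\times n}$, $B_c\in\mathbb{R}^{n\times m}$, $A_d\in\mathbb{R}^{n\times n}$, $B_d\in\mathbb{R}^{n\times m}$, and let $\bm{\Sigma}_c:\ \dot x_c(t)=A_cx_c(t)+B_cu_c(t)$ and $\bm{\Sigma}_d:\ x_d(i+1)=A_dx_d(i)+B_du_d(i)$. Let $\tau\in\mathbb{R}_{>0}$ be a sampling time and $N\ge 1$ an integer. Then $\bm{\Sigma}_c$ is an $N$-th order interpolator of $\bm{\Sigma}_d$ with respect to the sampling time $\tau$ if and only if for any $x_0\in\mathbb{R}^n$ and any $u_d:\{0,1\}\to\mathbb{R}^m$ there exists $u_c\in\mathbb{I}_N^\tau(u_d)$ such that $$x_c(\cdot;x_0,u_c)|_{[0,\tau]}\in\mathbb{I}_N^\tau\big(x_d(\cdot;x_0,u_d)|_{\{0,1\}}\big).$$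
   Context: For integers $k_1\le k_2$, $\llbracket k_1,k_2\rrbracket=\{k\in\mathbb{Z}: k_1\le k\le k_2\}$. $x_c(t;x_0,u_c)$ denotes the solution at time $t$ of $\dot x_c=A_cx_c+B_cu_c$ with $x_c(0)=x_0$ and input $u_c$; $x_d(i;x_0,u_d)$ denotes the solution at step $i$ of $x_d(i+1)=A_dx_d(i)+B_du_d(i)$ with $x_d(0)=x_0$ and input $u_d$. $f|_{I'}$ denotes restriction to $I'$. $\mathbb{P}_N^p$ is the space of $\mathbb{R}^p$-valued polynomials of degree at most $N$. Signal interpolation: for $\ell,p\in\mathbb{Z}_{>0}$ and $s_d:\llbracket 0,\ell\rrbracket\to\mathbb{R}^p$, a function $s_c:[0,\ell\tau]\to\mathbb{R}^p$ is an $N$-th order interpolation of $s_d$ with respect to the sampling time $\tau$ if there exist $P_0,\dots,P_{\ell-1}\in\mathbb{P}_N^p|_{[0,\tau]}$ such that for all $i\in\llbracket 0,\ell-1\rrbracket$: $s_c(i\tau)=s_d(i)$, $s_c((i+1)\tau)=s_d(i+1)$, and $s_c(i\tau+t)=P_i(t)$ for all $t\in[0,\tau]$. The set of all such $s_c$ is denoted $\mathbb{I}_N^\tau(s_d)$. System interpolation: $\bm{\Sigma}_c$ is an $N$-th order interpolator of $\bm{\Sigma}_d$ with respect to the sampling time $\tau$ if for any $\ell\in\mathbb{Z}_{>0}$, any $x_0\in\mathbb{R}^n$ and any $u_d:\llbracket 0,\ell\rrbracket\to\mathbb{R}^m$, there exists $u_c\in\mathbb{I}_N^\tau(u_d)$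 such that $x_c(\cdot;x_0,u_c)|_{[0,\ell\tau]}\in\mathbb{I}_N^\tau\big(x_d(\cdot;x_0,u_d)|_{\llbracket 0,\ell\rrbracket}\big)$. *)

theory Defs
  imports "HOL-Analysis.Analysis"
begin

definition ct_solution ::
  "real^'n^'n \<Rightarrow> real^'m^'n \<Rightarrow> real^'n \<Rightarrow> (real \<Rightarrow> real^'m) \<Rightarrow> real \<Rightarrow> (real \<Rightarrow> real^'n) \<Rightarrow> bool"
  where "ct_solution A B x0 u T x \<longleftrightarrow>
    x 0 = x0 \<and>
    (\<forall>t\<in>{0..T}. (x has_vector_derivative (A *v x t + B *v u t)) (at t within {0..T}))"

text \<open>
  The value at time \<open>t\<close> of the solution on \<open>[0, t]\<close>. It does not depend on the values of \<open>u\<close>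
  outside \<open>[0, t]\<close>. For inputs that are continuous on \<open>[0, T]\<close>, the lemmas
  \<open>ct_solution_ct_state\<close> and \<open>ct_solution_unique\<close> below show that \<open>ct_state A B x0 u\<close> is the
  unique solution on \<open>[0, T]\<close>.
\<close>
definition ct_state ::
  "real^'n^'n \<Rightarrow> real^'m^'n \<Rightarrow> real^'n \<Rightarrow> (real \<Rightarrow> real^'m) \<Rightarrow> real \<Rightarrow> real^'n"
  where "ct_state A B x0 u t = (THE y. \<exists>x. ct_solution A B x0 u t x \<and> x t = y)"

primrec dt_state ::
  "real^'n^'n \<Rightarrow> real^'m^'n \<Rightarrow> real^'n \<Rightarrow> (nat \<Rightarrow> real^'m) \<Rightarrow> nat \<Rightarrow> real^'n"
  where
    "dt_state A B x0 u 0 = x0"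
  | "dt_state A B x0 u (Suc i) = A *v dt_state A B x0 u i + B *v u i"

definition vec_polys :: "nat \<Rightarrow> (real \<Rightarrow> real^'p) set"
  where "vec_polys N = {P. \<exists>c. \<forall>t. P t = (\<Sum>k\<le>N. t ^ k *\<^sub>R c k)}"

text \<open>
  Signals on \<open>{0..l}\<close> and on the interval \<open>[0, l \<tau>]\<close> are represented by total functions.
  Membership in \<open>signal_interp N \<tau> l sd\<close> depends only on the restrictions of \<open>sd\<close> and of its
  interpolant to these domains, so restrictions need not be written.
\<close>
definition signal_interp ::
  "nat \<Rightarrow> real \<Rightarrow> nat \<Rightarrow> (nat \<Rightarrow> real^'p) \<Rightarrow> (real \<Rightarrow> real^'p) set"
  where "signal_interp N \<tau> l sd = {sc.
    \<exists>P. (\<forall>i<l. P i \<in> vec_polys N) \<and>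
      (\<forall>i<l. sc (real i * \<tau>) = sd i \<and> sc (real (i + 1) * \<tau>) = sd (i + 1) \<and>
        (\<forall>t\<in>{0..\<tau>}. sc (real i * \<tau> + t) = P i t))}"

definition system_interpolator ::
  "nat \<Rightarrow> real \<Rightarrow> real^'n^'n \<Rightarrow> real^'m^'n \<Rightarrow> real^'n^'n \<Rightarrow> real^'m^'n \<Rightarrow> bool"
  where "system_interpolator N \<tau> Ac Bc Ad Bd \<longleftrightarrow>
    (\<forall>l>0. \<forall>x0 ud. \<exists>uc\<in>signal_interp N \<tau> l ud.
      ct_state Ac Bc x0 uc \<in> signal_interp N \<tau> l (dt_state Ad Bd x0 ud))"

lemma ct_solution_subinterval:
  assumes "ct_solution A B x0 u T x" and "S \<le> T"
  shows "ct_solution A B x0 u S x"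
  using assms unfolding ct_solution_def
  by (auto intro: has_vector_derivative_within_subset[where S = "{0..T}"])

lemma ct_solution_unique:
  assumes x: "ct_solution A B x0 u T x" and y: "ct_solution A B x0 u T y"
    and t: "t \<in> {0..T}"
  shows "x t = y t"
proof -
  define z where "z = (\<lambda>t. x t - y t)"
  have z0: "z 0 = 0" using x y by (simp add: z_def ct_solution_def)
  have dz: "(z has_vector_derivative A *v z s) (at s within {0..T})" if "s \<in> {0..T}" for s
  proof -
    have "(z has_vector_derivative (A *v x s + B *v u s) - (A *v y s + B *v u s))
        (at s within {0..T})"
      using x y that unfolding z_def ct_solution_def
      by (intro has_vector_derivative_diff) auto
    then show ?thesis by (simp add: z_def matrix_vector_mult_diff_distrib)
  qed
  define K where "K = onorm ((*v) A)"
  have K: "norm (A *v v) \<le> K * norm v" for v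
    unfolding K_def by (rule onorm) simp
  define V where "V = (\<lambda>s. exp (- 2 * K * s) * (z s \<bullet> z s))"
  have dV: "(V has_real_derivative
      exp (- 2 * K * s) * (2 * (z s \<bullet> (A *v z s)) - 2 * K * (z s \<bullet> z s))) (at s within {0..T})"
    if "s \<in> {0..T}" for s
    unfolding V_def has_real_derivative_iff_has_vector_derivative has_vector_derivative_def
    by (rule has_derivative_eq_rhs)
      (auto intro!: derivative_eq_intros dz[OF that, unfolded has_vector_derivative_def]
        simp: fun_eq_iff algebra_simps inner_commute)
  have "V t \<le> V 0"
  proof (rule DERIV_nonpos_imp_decreasing_open[of 0 t V])
    show "0 \<le> t" using t by simp
    show "continuous_on {0..t} V"
      by (rule continuous_on_subset[OF DERIV_continuous_on[OF dV]]) (use t in auto)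
    fix s assume s: "0 < s" "s < t"
    have "at s within {0..T} = at s"
      using s t by (intro at_within_interior) (auto simp: interior_atLeastAtMost_real)
    moreover have "z s \<bullet> (A *v z s) \<le> K * (z s \<bullet> z s)"
    proof -
      have "z s \<bullet> (A *v z s) \<le> norm (z s) * norm (A *v z s)" by (rule norm_cauchy_schwarz)
      also have "\<dots> \<le> norm (z s) * (K * norm (z s))"
        by (rule mult_left_mono[OF K]) simp
      finally show ?thesis by (simp add: dot_square_norm power2_eq_square algebra_simps)
    qed
    ultimately have "(V has_real_derivative
        exp (- 2 * K * s) * (2 * (z s \<bullet> (A *v z s)) - 2 * K * (z s \<bullet> z s))) (at s)"
      and "exp (- 2 * K * s) * (2 * (z s \<bullet> (A *v z s)) - 2 * K * (z s \<bullet> z s)) \<le> 0"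
      using dV[of s] s t by (auto intro!: mult_nonneg_nonpos)
    then show "\<exists>D. (V has_real_derivative D) (at s) \<and> D \<le> 0" by blast
  qed
  then have "z t \<bullet> z t \<le> 0" by (simp add: V_def z0 mult_le_0_iff)
  then have "z t = 0" by (metis inner_eq_zero_iff inner_ge_zero order_antisym)
  then show ?thesis by (simp add: z_def)
qed

lemma ct_solution_exists:
  fixes A :: "real^'n^'n" and B :: "real^'m^'n"
  assumes u: "continuous_on {0..T} u"
  shows "\<exists>x. ct_solution A B x0 u T x"
proof (cases "0 \<le> T")
  case False
  then show ?thesis by (intro exI[of _ "\<lambda>_. x0"]) (simp add: ct_solution_def)
next
  case T: True
  define b where "b = (\<lambda>s. B *v u s)"
  have b: "continuous_on {0..T} b"
    unfolding b_def by (intro bounded_linear.continuous_on[OF matrix_vector_mul_bounded_linear] u)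
  define d where "d = rec_nat (\<lambda>t. x0 + integral {0..t} b) (\<lambda>_ f t. integral {0..t} (\<lambda>s. A *v f s))"
  have d0: "d 0 = (\<lambda>t. x0 + integral {0..t} b)"
    and dS: "d (Suc k) = (\<lambda>t. integral {0..t} (\<lambda>s. A *v d k s))" for k
    by (simp_all add: d_def)
  have dd0: "(d 0 has_vector_derivative b t) (at t within {0..T})" if "t \<in> {0..T}" for t
    unfolding d0 using integral_has_vector_derivative[OF b that]
    by (auto intro!: derivative_eq_intros)
  have cd: "continuous_on {0..T} (d k)" for k
  proof (induction k)
    case 0
    show ?case
      using dd0 by (intro continuous_on_vector_derivative) auto
  next
    case (Suc k)
    have "continuous_on {0..T} (\<lambda>s. A *v d k s)"
      by (intro bounded_linear.continuous_on[OF matrix_vector_mul_bounded_linear] Suc)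
    then show ?case
      unfolding dS by (metis continuous_on_vector_derivative integral_has_vector_derivative)
  qed
  have cAd: "continuous_on {0..T} (\<lambda>s. A *v d k s)" for k
    by (intro bounded_linear.continuous_on[OF matrix_vector_mul_bounded_linear] cd)
  have ddS: "(d (Suc k) has_vector_derivative A *v d k t) (at t within {0..T})"
    if "t \<in> {0..T}" for k t
    unfolding dS by (rule integral_has_vector_derivative[OF cAd that])
  define K where "K = onorm ((*v) A)"
  have K: "norm (A *v v) \<le> K * norm v" for v
    unfolding K_def by (rule onorm) simp
  have K0: "0 \<le> K" unfolding K_def by (rule onorm_pos_le) simp
  have "bounded (d 0 ` {0..T})"
    by (intro compact_imp_bounded compact_continuous_image cd) simp
  then obtain M where M: "\<And>t. t \<in> {0..T} \<Longrightarrow> norm (d 0 t) \<le> M"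
    by (metis bounded_iff imageI)
  have bd: "norm (d k t) \<le> M * (K * t) ^ k / fact k" if "t \<in> {0..T}" for k t
    using that
  proof (induction k arbitrary: t)
    case 0
    then show ?case using M by simp
  next
    case (Suc k)
    define G where "G = (\<lambda>s. M * (K * s) ^ Suc k / fact (Suc k))"
    have dG: "(G has_real_derivative K * (M * (K * s) ^ k / fact k)) (at s within {0..t})" for s
    proof -
      have "((\<lambda>s. (K * s) ^ Suc k) has_real_derivative real (Suc k) * (K * (K * s) ^ k))
          (at s within {0..t})"
        by (rule DERIV_cong[OF DERIV_power[OF DERIV_cmult_Id]]) simp
      from DERIV_cdivide[OF DERIV_cmult[OF this], of M "fact (Suc k)"]
      show ?thesis
        unfolding G_def by (rule DERIV_cong) simp
    qed
    have iG: "((\<lambda>s. K * (M * (K * s) ^ k / fact k)) has_integral G t - G 0) {0..t}"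
      using Suc.prems dG
      by (intro fundamental_theorem_of_calculus)
        (auto simp: has_real_derivative_iff_has_vector_derivative)
    have "norm (d (Suc k) t) \<le> integral {0..t} (\<lambda>s. K * (M * (K * s) ^ k / fact k))"
      unfolding dS
    proof (rule integral_norm_bound_integral)
      show "(\<lambda>s. A *v d k s) integrable_on {0..t}"
        by (rule integrable_continuous_real, rule continuous_on_subset[OF cAd])
          (use Suc.prems in auto)
      show "(\<lambda>s. K * (M * (K * s) ^ k / fact k)) integrable_on {0..t}"
        using iG by blast
      fix s assume "s \<in> {0..t}"
      then have "norm (d k s) \<le> M * (K * s) ^ k / fact k"
        using Suc by auto
      then show "norm (A *v d k s) \<le> K * (M * (K * s) ^ k / fact k)"
        by (intro order_trans[OF K] mult_left_mono K0)
    qed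
    also have "\<dots> = G t"
      using integral_unique[OF iG] by (simp add: G_def)
    finally show ?case by (simp add: G_def)
  qed
  have M0: "0 \<le> M" using order_trans[OF norm_ge_zero M[of 0]] T by simp
  have bdT: "norm (d k t) \<le> M * ((K * T) ^ k / fact k)" if "t \<in> {0..T}" for k t
  proof -
    have "M * (K * t) ^ k / fact k \<le> M * (K * T) ^ k / fact k"
      using that K0 M0 by (intro divide_right_mono mult_left_mono power_mono) auto
    then show ?thesis using bd[OF that, of k] by simp
  qed
  have sm: "summable (\<lambda>k. M * ((K * T) ^ k / fact k))"
    using summable_exp_generic[of "K * T"] by (intro summable_mult) (simp add: divide_inverse mult.commute)
  define X where "X = (\<lambda>t. \<Sum>k. d k t)"
  have ul: "uniform_limit {0..T} (\<lambda>n t. \<Sum>k<n. d k t) X sequentially"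
    unfolding X_def by (rule Weierstrass_m_test[OF bdT sm])
  have Xs: "(\<lambda>k. d k t) sums X t" if "t \<in> {0..T}" for t
    using tendsto_uniform_limitI[OF ul that] by (simp add: sums_def)
  define f' where "f' = (\<lambda>k t. case k of 0 \<Rightarrow> b t | Suc j \<Rightarrow> A *v d j t)"
  have df: "(d k has_vector_derivative f' k t) (at t within {0..T})" if "t \<in> {0..T}" for k t
    using dd0 ddS that by (cases k) (auto simp: f'_def)
  have sumf': "(\<Sum>k<Suc n. f' k t) = b t + A *v (\<Sum>k<n. d k t)" for n t
    by (simp add: f'_def sum.lessThan_Suc_shift linear_sum[OF matrix_vector_mul_linear]
        del: sum.lessThan_Suc)
  have "uniform_limit {0..T} (\<lambda>n t. b t + A *v (\<Sum>k<n. d k t)) (\<lambda>t. b t + A *v X t) sequentially"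
    by (intro uniform_limit_intros bounded_linear.uniform_limit[OF _ ul]) simp
  then have "uniform_limit {0..T} (\<lambda>n t. \<Sum>k<Suc n. f' k t) (\<lambda>t. b t + A *v X t) sequentially"
    by (simp only: sumf')
  then have ulf: "uniform_limit {0..T} (\<lambda>n t. \<Sum>k<n. f' k t) (\<lambda>t. b t + A *v X t) sequentially"
    unfolding uniform_limit_iff
    by (subst eventually_sequentially_Suc[symmetric]) simp
  have "\<exists>g. \<forall>t\<in>{0..T}. (\<lambda>k. d k t) sums g t \<and>
      (g has_derivative (\<lambda>h. h *\<^sub>R (b t + A *v X t))) (at t within {0..T})"
  proof (rule has_derivative_series[where f' = "\<lambda>k t h. h *\<^sub>R f' k t" and x = 0])
    show "(d k has_derivative (\<lambda>h. h *\<^sub>R f' k t)) (at t within {0..T})" if "t \<in> {0..T}" for k t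
      using df[OF that] by (simp add: has_vector_derivative_def)
    show "\<forall>\<^sub>F n in sequentially. \<forall>t\<in>{0..T}. \<forall>h.
        norm ((\<Sum>i<n. h *\<^sub>R f' i t) - h *\<^sub>R (b t + A *v X t)) \<le> e * norm h" if "0 < e" for e
      using uniform_limitD[OF ulf that]
    proof eventually_elim
      case (elim n)
      have "norm ((\<Sum>i<n. h *\<^sub>R f' i t) - h *\<^sub>R (b t + A *v X t)) \<le> e * norm h"
        if "t \<in> {0..T}" for t h
      proof -
        have "norm ((\<Sum>i<n. f' i t) - (b t + A *v X t)) \<le> e"
          using elim that by (auto simp: dist_norm less_imp_le)
        then have "norm (h *\<^sub>R ((\<Sum>i<n. f' i t) - (b t + A *v X t))) \<le> \<bar>h\<bar> * e"
          by (simp add: mult_left_mono)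
        then show ?thesis
          by (simp only: scaleR_diff_right scaleR_sum_right real_norm_def mult.commute)
      qed
      then show ?case by blast
    qed
    show "(\<lambda>k. d k 0) sums X 0" using Xs T by simp
  qed (use T in auto)
  then obtain g where gs: "\<And>t. t \<in> {0..T} \<Longrightarrow> (\<lambda>k. d k t) sums g t"
    and dg: "\<And>t. t \<in> {0..T} \<Longrightarrow>
      (g has_derivative (\<lambda>h. h *\<^sub>R (b t + A *v X t))) (at t within {0..T})"
    by blast
  have gX: "g t = X t" if "t \<in> {0..T}" for t
    using gs[OF that] Xs[OF that] by (rule sums_unique2)
  have "d k 0 = (if k = 0 then x0 else 0)" for k
    by (cases k) (simp_all add: d0 dS)
  then have "(\<lambda>k. d k 0) sums x0"
    using sums_single[of 0 "\<lambda>_. x0"] by simp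
  then have "g 0 = x0"
    using gs[of 0] T sums_unique2 by auto
  then have "ct_solution A B x0 u T g"
    using dg gX by (auto simp: ct_solution_def has_vector_derivative_def b_def add.commute)
  then show ?thesis by blast
qed

lemma ct_state_eq:
  assumes x: "ct_solution A B x0 u T x" and t: "t \<in> {0..T}"
  shows "ct_state A B x0 u t = x t"
  unfolding ct_state_def
proof (rule the_equality)
  have xt: "ct_solution A B x0 u t x"
    using ct_solution_subinterval[OF x] t by simp
  then show "\<exists>x'. ct_solution A B x0 u t x' \<and> x' t = x t" by blast
  show "y = x t" if "\<exists>x'. ct_solution A B x0 u t x' \<and> x' t = y" for y
    using that ct_solution_unique[OF _ xt] t by auto
qed

lemma ct_solution_ct_state:
  assumes "continuous_on {0..T} u" and T: "0 \<le> T"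
  shows "ct_solution A B x0 u T (ct_state A B x0 u)"
proof -
  obtain x where x: "ct_solution A B x0 u T x"
    using ct_solution_exists[OF assms(1)] by blast
  have eq: "ct_state A B x0 u t = x t" if "t \<in> {0..T}" for t
    using ct_state_eq[OF x that] .
  have "(ct_state A B x0 u has_vector_derivative (A *v x t + B *v u t)) (at t within {0..T})"
    if "t \<in> {0..T}" for t
    by (rule has_vector_derivative_transform[OF that eq])
      (use x that in \<open>auto simp: ct_solution_def\<close>)
  then show ?thesis
    using x eq T by (auto simp: ct_solution_def)
qed

end

theory Submission
  imports Defs
begin

text \<open>
  An interpolating input on \<open>[0, l\<tau>]\<close> is extended to \<open>[0, (l + 1)\<tau>]\<close> by appending the
  one-step input that belongs to the state reached at step \<open>l\<close>. The two pieces both take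
  the value \<open>u\<^sub>d l\<close> at the junction, so the extended input is continuous, and time invariance
  of both systems identifies the new piece of the trajectory with a one-step trajectory.
\<close>

text \<open>Every point at which the interpolation conditions evaluate the signal is
  \<open>i \<tau> + t\<close> with \<open>i < l\<close> and \<open>t \<in> {0..\<tau>}\<close>,
  hence lies in \<open>{0..l \<tau>}\<close>. This lets a glued signal inherit membership from its
  pieces.\<close>

lemma signal_interp_transform:
  assumes "0 < \<tau>" and "g \<in> signal_interp N \<tau> l sd"
    and "\<And>t. t \<in> {0..real l * \<tau>} \<Longrightarrow> f t = g t"
  shows "f \<in> signal_interp N \<tau> l sd"
proof -
  have "f (real i * \<tau> + t) = g (real i * \<tau> + t)" if "i < l" "t \<in> {0..\<tau>}" for i t
  proof (rule assms(3))
    have "real i * \<tau> + t \<le> real (i + 1) * \<tau>"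
      using that by (simp add: algebra_simps)
    also have "\<dots> \<le> real l * \<tau>"
      using that assms(1) by (intro mult_right_mono) auto
    finally show "real i * \<tau> + t \<in> {0..real l * \<tau>}"
      using that assms(1) by simp
  qed
  \<comment> \<open>The instances \<open>t = 0\<close> and \<open>t = \<tau>\<close> cover the two
    endpoint conditions of each segment.\<close>
  note eq = this this[of _ 0] this[of _ \<tau>]
  have "f (real i * \<tau>) = g (real i * \<tau>)" "f (real (i + 1) * \<tau>) = g (real (i + 1) * \<tau>)"
    if "i < l" for i
    using eq(2,3)[OF that] assms(1) by (simp_all add: algebra_simps)
  then show ?thesis
    using eq(1) assms(2) by (simp add: signal_interp_def)
qed

text \<open>By choice, the family of polynomials may be picked one segment at a time, which makes
  the segments independent of each other.\<close>

lemma signal_interp_iff: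
  "sc \<in> signal_interp N \<tau> l sd \<longleftrightarrow>
    (\<forall>i<l. \<exists>P\<in>vec_polys N. sc (real i * \<tau>) = sd i \<and> sc (real (i + 1) * \<tau>) = sd (i + 1) \<and>
      (\<forall>t\<in>{0..\<tau>}. sc (real i * \<tau> + t) = P t))"
  (is "_ \<longleftrightarrow> (\<forall>i<l. \<exists>P\<in>vec_polys N. ?Q i P)")
proof -
  have "sc \<in> signal_interp N \<tau> l sd \<longleftrightarrow> (\<exists>P. \<forall>i. i < l \<longrightarrow> P i \<in> vec_polys N \<and> ?Q i (P i))"
    unfolding signal_interp_def mem_Collect_eq by (intro iff_exI) blast
  also have "\<dots> \<longleftrightarrow> (\<forall>i. \<exists>p. i < l \<longrightarrow> p \<in> vec_polys N \<and> ?Q i p)"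
    by (rule choice_iff[symmetric])
  finally show ?thesis by blast
qed

text \<open>The condition on segment \<open>l\<close> is the condition on segment 0 of the signal
  shifted by \<open>l \<tau>\<close>; this splits off the last segment in inductions.\<close>

lemma signal_interp_Suc:
  "sc \<in> signal_interp N \<tau> (Suc l) sd \<longleftrightarrow>
    sc \<in> signal_interp N \<tau> l sd \<and>
    (\<lambda>t. sc (real l * \<tau> + t)) \<in> signal_interp N \<tau> 1 (\<lambda>i. sd (l + i))"
  by (simp add: signal_interp_iff All_less_Suc algebra_simps conj_ac)

text \<open>This is the right endpoint condition of segment \<open>l - 1\<close>. For
  \<open>l = 0\<close> membership is vacuous, so \<open>l\<close> must be positive.\<close>

lemma signal_interp_final:
  assumes "0 < l" and "sc \<in> signal_interp N \<tau> l sd"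
  shows "sc (real l * \<tau>) = sd l"
proof -
  obtain k where "l = k + 1"
    using assms(1) by (metis Suc_eq_plus1 gr0_implies_Suc)
  then show ?thesis
    using assms(2) by (simp add: signal_interp_iff)
qed

lemma continuous_on_vec_polys:
  assumes "P \<in> vec_polys N"
  shows "continuous_on S P"
proof -
  obtain c where "P = (\<lambda>t. \<Sum>k\<le>N. t ^ k *\<^sub>R c k)"
    using assms by (auto simp: vec_polys_def)
  then show ?thesis
    by (auto intro!: continuous_intros)
qed

text \<open>Each segment is a polynomial on a closed interval, and neighbouring intervals share
  their breakpoint, so the pieces glue. Continuity of the input guarantees that
  \<open>ct_state\<close> is an actual solution.\<close>

lemma continuous_on_signal_interp:
  assumes "0 < \<tau>" and "sc \<in> signal_interp N \<tau> l sd"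
  shows "continuous_on {0..real l * \<tau>} sc"
  using assms(2)
proof (induction l)
  case 0
  then show ?case by simp
next
  case (Suc l)
  let ?a = "real l * \<tau>"
  obtain P where P: "P \<in> vec_polys N" "\<And>t. t \<in> {0..\<tau>} \<Longrightarrow> sc (?a + t) = P t"
    using Suc.prems unfolding signal_interp_iff by blast
  have "continuous_on {?a..?a + \<tau>} (\<lambda>t. P (t - ?a))"
    by (rule continuous_on_compose2[OF continuous_on_vec_polys[OF P(1), of UNIV]])
      (auto intro!: continuous_intros)
  moreover have "P (t - ?a) = sc t" if "t \<in> {?a..?a + \<tau>}" for t
    using P(2)[of "t - ?a"] that by simp
  ultimately have "continuous_on {?a..?a + \<tau>} sc"
    by (rule continuous_on_eq)
  moreover have "continuous_on {0..?a} sc"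
    using Suc.IH Suc.prems signal_interp_Suc by blast
  ultimately have "continuous_on ({0..?a} \<union> {?a..?a + \<tau>}) sc"
    by (intro continuous_on_closed_Un) auto
  moreover have "{0..?a} \<union> {?a..?a + \<tau>} = {0..real (Suc l) * \<tau>}"
    using assms(1) by (subst ivl_disj_un_two_touch) (auto simp: algebra_simps)
  ultimately show ?case by simp
qed

lemma ct_state_cong:
  assumes "\<And>s. s \<in> {0..t} \<Longrightarrow> u s = v s"
  shows "ct_state A B x0 u t = ct_state A B x0 v t"
  using assms by (simp add: ct_state_def ct_solution_def)

text \<open>Time invariance: the trajectory shifted by \<open>S\<close> solves the equation with
  shifted input and initial state \<open>ct_state A B x0 u S\<close>, and solutions are
  unique.\<close>

lemma ct_state_add:
  assumes u: "continuous_on {0..S + t} u" and "0 \<le> S" and "0 \<le> t"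
  shows "ct_state A B x0 u (S + t) = ct_state A B (ct_state A B x0 u S) (\<lambda>s. u (S + s)) t"
proof -
  let ?x = "ct_state A B x0 u"
  have x: "ct_solution A B x0 u (S + t) ?x"
    using ct_solution_ct_state[OF u] assms by simp
  have "((?x \<circ> (+) S) has_vector_derivative 1 *\<^sub>R (A *v ?x (S + s) + B *v u (S + s)))
      (at s within {0..t})" if "s \<in> {0..t}" for s
  proof (rule vector_diff_chain_within)
    show "((+) S has_vector_derivative 1) (at s within {0..t})"
      by (auto intro!: derivative_eq_intros)
    have "(?x has_vector_derivative (A *v ?x (S + s) + B *v u (S + s)))
        (at (S + s) within {0..S + t})"
      using x that assms unfolding ct_solution_def by auto
    \<comment> \<open>The chain rule asks for the derivative within the image of the shift,
      \<open>{S..S + t}\<close>, a subset of \<open>{0..S + t}\<close>.\<close>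
    then show "(?x has_vector_derivative (A *v ?x (S + s) + B *v u (S + s)))
        (at (S + s) within (+) S ` {0..t})"
      by (rule has_vector_derivative_within_subset) (use assms in auto)
  qed
  then have "ct_solution A B (?x S) (\<lambda>s. u (S + s)) t (\<lambda>s. ?x (S + s))"
    by (simp add: ct_solution_def o_def)
  then show ?thesis
    using ct_state_eq[of A B "?x S" _ t _ t] assms by simp
qed

lemma dt_state_add:
  "dt_state A B x0 u (l + i) = dt_state A B (dt_state A B x0 u l) (\<lambda>j. u (l + j)) i"
  by (induction i) simp_all

lemma interpolator_append_step:
  assumes "0 < \<tau>" and "0 < l"
    and uc: "uc \<in> signal_interp N \<tau> l ud"
    and xc: "ct_state Ac Bc x0 uc \<in> signal_interp N \<tau> l (dt_state Ad Bd x0 ud)"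
    and v: "v \<in> signal_interp N \<tau> 1 (\<lambda>i. ud (l + i))"
    and y: "ct_state Ac Bc (dt_state Ad Bd x0 ud l) v
      \<in> signal_interp N \<tau> 1 (dt_state Ad Bd (dt_state Ad Bd x0 ud l) (\<lambda>i. ud (l + i)))"
  shows "\<exists>w\<in>signal_interp N \<tau> (Suc l) ud.
    ct_state Ac Bc x0 w \<in> signal_interp N \<tau> (Suc l) (dt_state Ad Bd x0 ud)"
proof -
  let ?a = "real l * \<tau>" and ?xd = "dt_state Ad Bd x0 ud"
  define w where "w = (\<lambda>t. if t < ?a then uc t else v (t - ?a))"
  have a: "0 \<le> ?a" using assms by simp
  \<comment> \<open>At the junction \<open>w\<close> takes the value \<open>v 0\<close>; it agrees
    with \<open>uc\<close> there because both equal \<open>ud l\<close>.\<close>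
  have "v 0 = ud l"
    using v by (simp add: signal_interp_iff)
  then have w_uc: "w t = uc t" if "t \<in> {0..?a}" for t
    using that signal_interp_final[OF assms(2) uc] by (cases "t = ?a") (auto simp: w_def)
  \<comment> \<open>The bound \<open>real 1 * \<tau>\<close> has the shape that
    \<open>signal_interp_transform\<close> requires for one segment.\<close>
  have w_v: "w (?a + t) = v t" if "t \<in> {0..real 1 * \<tau>}" for t
    using that by (simp add: w_def)
  have w: "w \<in> signal_interp N \<tau> (Suc l) ud"
    unfolding signal_interp_Suc
    using signal_interp_transform[OF assms(1) uc w_uc] signal_interp_transform[OF assms(1) v w_v]
    by (rule conjI)
  have x_w: "ct_state Ac Bc x0 w t = ct_state Ac Bc x0 uc t" if "t \<in> {0..?a}" for t
    by (rule ct_state_cong) (use that w_uc in auto)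
  have "ct_state Ac Bc x0 w ?a = ?xd l"
    using x_w[of ?a] a signal_interp_final[OF assms(2) xc] by simp
  moreover have "ct_state Ac Bc x0 w (?a + t) =
      ct_state Ac Bc (ct_state Ac Bc x0 w ?a) (\<lambda>s. w (?a + s)) t" if "t \<in> {0..real 1 * \<tau>}" for t
    by (rule ct_state_add[OF continuous_on_subset[OF continuous_on_signal_interp[OF assms(1) w]]])
      (use that a in \<open>auto simp: algebra_simps\<close>)
  moreover have "ct_state Ac Bc z (\<lambda>s. w (?a + s)) t = ct_state Ac Bc z v t"
    if "t \<in> {0..real 1 * \<tau>}" for z t
    by (rule ct_state_cong) (use that w_v in auto)
  ultimately have x_v: "ct_state Ac Bc x0 w (?a + t) = ct_state Ac Bc (?xd l) v t"
    if "t \<in> {0..real 1 * \<tau>}" for t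
    using that by simp
  \<comment> \<open>Unfolding \<open>dt_state_add\<close> turns the shifted discrete trajectory into
    the one restarted at \<open>?xd l\<close>, as in \<open>y\<close>.\<close>
  have "ct_state Ac Bc x0 w \<in> signal_interp N \<tau> (Suc l) ?xd"
    unfolding signal_interp_Suc dt_state_add
    using signal_interp_transform[OF assms(1) xc x_w] signal_interp_transform[OF assms(1) y x_v]
    by (rule conjI)
  with w show ?thesis by blast
qed

theorem proposition1:
  fixes Ac Ad :: "real^'n^'n" and Bc Bd :: "real^'m^'n"
    and \<tau> :: real and N :: nat
  assumes "\<tau> > 0" and "N \<ge> 1"
  shows "system_interpolator N \<tau> Ac Bc Ad Bd \<longleftrightarrow>
    (\<forall>x0 ud. \<exists>uc\<in>signal_interp N \<tau> 1 ud.
      ct_state Ac Bc x0 uc \<in> signal_interp N \<tau> 1 (dt_state Ad Bd x0 ud))"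
proof
  assume "system_interpolator N \<tau> Ac Bc Ad Bd"
  then show "\<forall>x0 ud. \<exists>uc\<in>signal_interp N \<tau> 1 ud.
      ct_state Ac Bc x0 uc \<in> signal_interp N \<tau> 1 (dt_state Ad Bd x0 ud)"
    unfolding system_interpolator_def using zero_less_one by blast
next
  assume step: "\<forall>x0 ud. \<exists>uc\<in>signal_interp N \<tau> 1 ud.
      ct_state Ac Bc x0 uc \<in> signal_interp N \<tau> 1 (dt_state Ad Bd x0 ud)"
  have "\<exists>uc\<in>signal_interp N \<tau> l ud.
      ct_state Ac Bc x0 uc \<in> signal_interp N \<tau> l (dt_state Ad Bd x0 ud)" if "0 < l" for l x0 ud
    using that
  proof (induction l rule: nat_induct_non_zero)
    case 1
    show ?case using step by blast
  next
    case (Suc l)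
    obtain uc where "uc \<in> signal_interp N \<tau> l ud"
      "ct_state Ac Bc x0 uc \<in> signal_interp N \<tau> l (dt_state Ad Bd x0 ud)"
      using Suc.IH by blast
    \<comment> \<open>The one-step hypothesis is applied to the discrete state at step
      \<open>l\<close> and the input shifted by \<open>l\<close>.\<close>
    moreover obtain v where "v \<in> signal_interp N \<tau> 1 (\<lambda>i. ud (l + i))"
      "ct_state Ac Bc (dt_state Ad Bd x0 ud l) v
        \<in> signal_interp N \<tau> 1 (dt_state Ad Bd (dt_state Ad Bd x0 ud l) (\<lambda>i. ud (l + i)))"
      using step by blast
    ultimately show ?case
      by (rule interpolator_append_step[OF assms(1) Suc.hyps])
  qed
  then show "system_interpolator N \<tau> Ac Bc Ad Bd"
    unfolding system_interpolator_def by blast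
qed

end
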